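(* Let $\mathcal{S}$ be a federated Byzantine quorum system over $\mathbf{V}$ with quorum intersection. Then the relaxed Stellar broadcast over $\mathcal{S}$ (Bracha broadcast with only the fail-prone-system condition replaced by the $v$-blocking condition, as defined in the context) satisfies the specification of reliable Byzantine broadcast (Validity, No duplication, Integrity, Consistency and Totality) in every execution in which at least one server in $\mathcal{S}$ is intact.
   Context: System model. There is a set of clients $\mathbf{C}$ and a disjoint finite non-empty set of servers $\mathbf{V}$. In an execution each node (client or server) is either correct (follows its protocol) or faulty (Byzantine: behaves arbitrarily). One distinguished client $c$ is the sender; it may be correct or faulty. Any two nodes communicate over an asynchronous point-to-point channel. If both endpoints are correct, the channel is authenticated and reliable: a correct node receives (eventually, after an arbitrary finite delay) a message from another correct node if and only if the latter sent it. Servers also send messages to themselves. Executions are complete: a handler of a correct server that stays enabled is eventually executed. A correct sender broadcasts at most one value. All servers act according to the same FBQS $\mathcal{S}$. Federated Byzantine quorum system (FBQS) over $\mathbf{V}$: a function $\mathcal{S}$ assigning to each $v\in\mathbf{V}$ a non-empty set $\mathcal{S}(v)\subseteq 2^{\mathbf{V}}$ of quorum slices, with $v\in q$ for all $q\in\mathcal{S}(v)$. A non-empty $U\subseteq\mathbf{V}$ is a quorum in $\mathcal{S}$ if $\forall v\in U.\ \exists q\in\mathcal{S}(v).\ q\subseteq U$; let $\mathcal{Q}$ be the set of all quorums in $\mathcal{S}$. $\mathcal{S}$ has quorum intersection if any two of its quorums intersect. For $I\subseteq\mathbf{V}$, $\mathcal{S}|_I$ is the FBQS over universe $I$ with $\mathcal{S}|_I(v)=\{q\cap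 I\mid q\in\mathcal{S}(v)\}$. Given the set of faulty servers $\mathbf{V}_{\mathrm{bad}}$, the set $\mathbf{V}_{\mathrm{int}}$ of intact servers in $\mathcal{S}$ is the biggest set such that $\mathbf{V}_{\mathrm{int}}\cap\mathbf{V}_{\mathrm{bad}}=\emptyset$; if $\mathbf{V}_{\mathrm{int}}$ is non-empty then it is a quorum in $\mathcal{S}$; and $\mathcal{S}|_{\mathbf{V}_{\mathrm{int}}}$ has quorum intersection. (For FBQSes with quorum intersection this set exists and is unique.) A set $B\subseteq\mathbf{V}$ is $v$-blocking if $q\cap B\neq\emptyset$ for every $q\in\mathcal{S}(v)$. Relaxed Stellar broadcast over $\mathcal{S}$ (servers may use quorums they do not belong to). To broadcast a value $a$, the sender $c$ sends $\mathtt{BCAST}(a)$ to every server. Each server $v$ has Boolean variables echoed, ready, delivered, all initially false, and the following handlers. (1) When $v$ has received $\mathtt{BCAST}(a)$ from $c$ and echoed is false: set echoed to true and send $\mathtt{ECHO}(a)$ to every server. (2) When $v$ has received $\mathtt{ECHO}(a)$ from every $u\in U$ for some $U\in\mathcal{Q}$, and ready is false: set ready to true and send $\mathtt{READY}(a)$ to every server. (3) When $v$ has received $\mathtt{READY}(a)$ from every $u\in B$ for some non-empty $v$-blocking $B\subseteq\mathbf{V}$, and ready is false: set ready to true and send $\mathtt{READY}(a)$ to every server. (4) When $v$ has received $\mathtt{READY}(a)$ from every $u\in U$ for some $U\in\mathcal{Q}$, and delivered is false: set delivered to true and deliver $a$. Reliable Byzantine broadcast. Validity: if the sender is correct and broadcasts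 a value $a$, then every correct server eventually delivers $a$. No duplication: every correct server delivers at most one value. Integrity: if some correct server delivers a value $a$ and the sender is correct, then $a$ was previously broadcast by the sender. Consistency: if some correct server delivers $a$ and another correct server delivers $a'$, then $a=a'$. Totality: if a correct server delivers a value, then every correct server eventually delivers a value. *)

theory Defs
  imports Main
begin

definition fbqs :: "'n set \<Rightarrow> ('n \<Rightarrow> 'n set set) \<Rightarrow> bool" where
  "fbqs V S \<longleftrightarrow> (\<forall>v\<in>V. S v \<noteq> {} \<and> (\<forall>q\<in>S v. q \<subseteq> V \<and> v \<in> q))"

definition quorums :: "'n set \<Rightarrow> ('n \<Rightarrow> 'n set set) \<Rightarrow> 'n set set" where
  "quorums V S = {U. U \<noteq> {} \<and> U \<subseteq> V \<and> (\<forall>v\<in>U. \<exists>q\<in>S v. q \<subseteq> U)}"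

definition quorum_intersection :: "'n set \<Rightarrow> ('n \<Rightarrow> 'n set set) \<Rightarrow> bool" where
  "quorum_intersection V S \<longleftrightarrow> (\<forall>U\<in>quorums V S. \<forall>U'\<in>quorums V S. U \<inter> U' \<noteq> {})"

definition restrict_fbqs :: "('n \<Rightarrow> 'n set set) \<Rightarrow> 'n set \<Rightarrow> 'n \<Rightarrow> 'n set set" where
  "restrict_fbqs S I v = {q \<inter> I | q. q \<in> S v}"

text \<open>\<open>F\<close> is the set of faulty servers. The greatest element is taken with respect to
  inclusion; it exists and is unique when \<open>V\<close> is finite and \<open>S\<close> has quorum intersection.\<close>

definition intact :: "'n set \<Rightarrow> ('n \<Rightarrow> 'n set set) \<Rightarrow> 'n set \<Rightarrow> 'n set" where
  "intact V S F = (GREATEST I. I \<subseteq> V \<and> I \<inter> F = {} \<and> (I \<noteq> {} \<longrightarrow> I \<in> quorums V S) \<and>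
     quorum_intersection I (restrict_fbqs S I))"

definition blocking :: "('n \<Rightarrow> 'n set set) \<Rightarrow> 'n \<Rightarrow> 'n set \<Rightarrow> bool" where
  "blocking S v B \<longleftrightarrow> (\<forall>q\<in>S v. q \<inter> B \<noteq> {})"

datatype 'a msg = BCAST 'a | ECHO 'a | READY 'a

record ('n, 'a) local_state =
  echoed :: bool
  ready :: bool
  delivered :: bool
  rcvd :: "('n \<times> 'a msg) set"

text \<open>\<open>rcvd\<close> pairs each received message with its origin. The triples in \<open>sent\<close> are
  (origin, destination, message); a message stays in \<open>sent\<close> after it has been received.\<close>

record ('n, 'a) config =
  loc :: "'n \<Rightarrow> ('n, 'a) local_state"
  sent :: "('n \<times> 'n \<times> 'a msg) set"

definition init_config :: "('n, 'a) config" where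
  "init_config =
     \<lparr>loc = (\<lambda>_. \<lparr>echoed = False, ready = False, delivered = False, rcvd = {}\<rparr>), sent = {}\<rparr>"

datatype handler = Echo | Ready_Quorum | Ready_Blocking | Deliver

fun enabled :: "'n set \<Rightarrow> 'n \<Rightarrow> ('n \<Rightarrow> 'n set set) \<Rightarrow> ('n, 'a) config \<Rightarrow> 'n \<Rightarrow> handler \<Rightarrow> 'a \<Rightarrow> bool"
where
  "enabled V c S s v Echo a \<longleftrightarrow> (c, BCAST a) \<in> rcvd (loc s v) \<and> \<not> echoed (loc s v)"
| "enabled V c S s v Ready_Quorum a \<longleftrightarrow>
     (\<exists>U\<in>quorums V S. \<forall>u\<in>U. (u, ECHO a) \<in> rcvd (loc s v)) \<and> \<not> ready (loc s v)"
| "enabled V c S s v Ready_Blocking a \<longleftrightarrow>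
     (\<exists>B. B \<subseteq> V \<and> B \<noteq> {} \<and> blocking S v B \<and> (\<forall>u\<in>B. (u, READY a) \<in> rcvd (loc s v))) \<and>
     \<not> ready (loc s v)"
| "enabled V c S s v Deliver a \<longleftrightarrow>
     (\<exists>U\<in>quorums V S. \<forall>u\<in>U. (u, READY a) \<in> rcvd (loc s v)) \<and> \<not> delivered (loc s v)"

definition set_local :: "'n \<Rightarrow> ('n, 'a) local_state \<Rightarrow> ('n, 'a) config \<Rightarrow> ('n, 'a) config" where
  "set_local v l s = s\<lparr>loc := (loc s)(v := l)\<rparr>"

definition send_all :: "'n set \<Rightarrow> 'n \<Rightarrow> 'a msg \<Rightarrow> ('n, 'a) config \<Rightarrow> ('n, 'a) config" where
  "send_all V u m s = s\<lparr>sent := sent s \<union> {(u, v, m) | v. v \<in> V}\<rparr>"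

text \<open>The act of delivering \<open>a\<close> is the occurrence of the event \<open>Handle v Deliver a\<close> below.\<close>

fun effect :: "'n set \<Rightarrow> 'n \<Rightarrow> handler \<Rightarrow> 'a \<Rightarrow> ('n, 'a) config \<Rightarrow> ('n, 'a) config" where
  "effect V v Echo a s = send_all V v (ECHO a) (set_local v ((loc s v)\<lparr>echoed := True\<rparr>) s)"
| "effect V v Ready_Quorum a s =
     send_all V v (READY a) (set_local v ((loc s v)\<lparr>ready := True\<rparr>) s)"
| "effect V v Ready_Blocking a s =
     send_all V v (READY a) (set_local v ((loc s v)\<lparr>ready := True\<rparr>) s)"
| "effect V v Deliver a s = set_local v ((loc s v)\<lparr>delivered := True\<rparr>) s"

text \<open>\<open>Receive v u m\<close>: the correct server \<open>v\<close> receives \<open>m\<close> on its channel from \<open>u\<close>.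
  \<open>Broadcast\<close>, \<open>Receive\<close> and \<open>Handle\<close> are events of correct nodes only; everything a faulty
  node does is a \<open>Byzantine\<close> event.\<close>

datatype ('n, 'a) event =
  Broadcast 'a | Receive 'n 'n "'a msg" | Handle 'n handler 'a | Byzantine 'n | Idle

text \<open>A message received from a faulty node is not constrained by \<open>sent\<close>, since nothing is assumed
  about channels with a faulty endpoint. A \<open>Byzantine\<close> event may change the faulty node's state and
  its outgoing messages arbitrarily, but nothing belonging to another node.\<close>

inductive step :: "'n set \<Rightarrow> 'n set \<Rightarrow> 'n \<Rightarrow> 'n set \<Rightarrow> ('n \<Rightarrow> 'n set set) \<Rightarrow>
    ('n, 'a) config \<Rightarrow> ('n, 'a) event \<Rightarrow> ('n, 'a) config \<Rightarrow> bool"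
  for C V c Bad S where
  broadcast: "c \<notin> Bad \<Longrightarrow> step C V c Bad S s (Broadcast a) (send_all V c (BCAST a) s)"
| receive: "v \<in> V - Bad \<Longrightarrow> u \<in> C \<union> V \<Longrightarrow> (u \<notin> Bad \<Longrightarrow> (u, v, m) \<in> sent s) \<Longrightarrow>
    step C V c Bad S s (Receive v u m)
      (set_local v ((loc s v)\<lparr>rcvd := insert (u, m) (rcvd (loc s v))\<rparr>) s)"
| handle: "v \<in> V - Bad \<Longrightarrow> enabled V c S s v h a \<Longrightarrow>
    step C V c Bad S s (Handle v h a) (effect V v h a s)"
| byzantine: "b \<in> Bad \<Longrightarrow> (\<And>u. u \<noteq> b \<Longrightarrow> loc s' u = loc s u) \<Longrightarrow>
    (\<And>u v m. u \<noteq> b \<Longrightarrow> (u, v, m) \<in> sent s' \<longleftrightarrow> (u, v, m) \<in> sent s) \<Longrightarrow>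
    step C V c Bad S s (Byzantine b) s'"
| idle: "step C V c Bad S s Idle s"

text \<open>\<open>\<sigma> t\<close> is the configuration before the event \<open>\<epsilon> t\<close>; finite executions are extended by \<open>Idle\<close>.
  The last two conjuncts are the liveness requirements: reliability of channels between correct
  nodes and weak fairness for the handlers of correct servers.\<close>

definition execution :: "'n set \<Rightarrow> 'n set \<Rightarrow> 'n \<Rightarrow> 'n set \<Rightarrow> ('n \<Rightarrow> 'n set set) \<Rightarrow>
    (nat \<Rightarrow> ('n, 'a) config) \<Rightarrow> (nat \<Rightarrow> ('n, 'a) event) \<Rightarrow> bool" where
  "execution C V c Bad S \<sigma> \<epsilon> \<longleftrightarrow>
     \<sigma> 0 = init_config \<and>
     (\<forall>t. step C V c Bad S (\<sigma> t) (\<epsilon> t) (\<sigma> (Suc t))) \<and>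
     (\<forall>t t' a a'. \<epsilon> t = Broadcast a \<and> \<epsilon> t' = Broadcast a' \<longrightarrow> a = a') \<and>
     (\<forall>t u m. \<forall>v\<in>V - Bad. u \<notin> Bad \<and> (u, v, m) \<in> sent (\<sigma> t) \<longrightarrow>
        (\<exists>t'. (u, m) \<in> rcvd (loc (\<sigma> t') v))) \<and>
     (\<forall>t h a. \<forall>v\<in>V - Bad. (\<forall>t'\<ge>t. enabled V c S (\<sigma> t') v h a) \<longrightarrow>
        (\<exists>t'\<ge>t. \<epsilon> t' = Handle v h a))"

definition delivers_at :: "(nat \<Rightarrow> ('n, 'a) event) \<Rightarrow> nat \<Rightarrow> 'n \<Rightarrow> 'a \<Rightarrow> bool" where
  "delivers_at \<epsilon> t v a \<longleftrightarrow> \<epsilon> t = Handle v Deliver a"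

definition validity :: "'n set \<Rightarrow> 'n \<Rightarrow> 'n set \<Rightarrow> (nat \<Rightarrow> ('n, 'a) event) \<Rightarrow> bool" where
  "validity V c Bad \<epsilon> \<longleftrightarrow>
     (\<forall>t a. c \<notin> Bad \<and> \<epsilon> t = Broadcast a \<longrightarrow> (\<forall>v\<in>V - Bad. \<exists>t'. delivers_at \<epsilon> t' v a))"

definition no_duplication :: "'n set \<Rightarrow> 'n set \<Rightarrow> (nat \<Rightarrow> ('n, 'a) event) \<Rightarrow> bool" where
  "no_duplication V Bad \<epsilon> \<longleftrightarrow>
     (\<forall>v\<in>V - Bad. \<forall>t t' a a'. delivers_at \<epsilon> t v a \<and> delivers_at \<epsilon> t' v a' \<longrightarrow> t = t' \<and> a = a')"

definition integrity :: "'n set \<Rightarrow> 'n \<Rightarrow> 'n set \<Rightarrow> (nat \<Rightarrow> ('n, 'a) event) \<Rightarrow> bool" where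
  "integrity V c Bad \<epsilon> \<longleftrightarrow>
     (\<forall>v\<in>V - Bad. \<forall>t a. delivers_at \<epsilon> t v a \<and> c \<notin> Bad \<longrightarrow> (\<exists>t'<t. \<epsilon> t' = Broadcast a))"

definition consistency :: "'n set \<Rightarrow> 'n set \<Rightarrow> (nat \<Rightarrow> ('n, 'a) event) \<Rightarrow> bool" where
  "consistency V Bad \<epsilon> \<longleftrightarrow>
     (\<forall>v\<in>V - Bad. \<forall>v'\<in>V - Bad. \<forall>t t' a a'.
        delivers_at \<epsilon> t v a \<and> delivers_at \<epsilon> t' v' a' \<longrightarrow> a = a')"

definition totality :: "'n set \<Rightarrow> 'n set \<Rightarrow> (nat \<Rightarrow> ('n, 'a) event) \<Rightarrow> bool" where
  "totality V Bad \<epsilon> \<longleftrightarrow>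
     (\<forall>v\<in>V - Bad. \<forall>t a. delivers_at \<epsilon> t v a \<longrightarrow> (\<forall>v'\<in>V - Bad. \<exists>t' a'. delivers_at \<epsilon> t' v' a'))"

definition reliable_byzantine_broadcast ::
    "'n set \<Rightarrow> 'n \<Rightarrow> 'n set \<Rightarrow> (nat \<Rightarrow> ('n, 'a) event) \<Rightarrow> bool" where
  "reliable_byzantine_broadcast V c Bad \<epsilon> \<longleftrightarrow>
     validity V c Bad \<epsilon> \<and> no_duplication V Bad \<epsilon> \<and> integrity V c Bad \<epsilon> \<and>
     consistency V Bad \<epsilon> \<and> totality V Bad \<epsilon>"

end

theory Submission
  imports Defs
begin

text \<open>Let \<open>I\<close> be the set of intact servers. Any two quorums of the full system meet inside \<open>I\<close>,
  since their traces on \<open>I\<close> are quorums of the restricted system, and a set blocking an intact server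
  contains an intact server. Hence the first intact server that sends \<open>READY a\<close> has seen an
  \<open>ECHO a\<close> quorum, and two such quorums share an intact server, which echoes only once: all intact
  servers that become ready do so for the same value. Any quorum that supports a delivery, even by a
  correct server that is not intact, contains an intact server, which gives integrity and consistency.
  For totality, if the intact servers that never become ready were a non-empty set, they would form a
  quorum of the restricted system: each of them is not blocked by the ready intact servers, so it has a
  slice avoiding them. That quorum would be disjoint from the trace of the delivering quorum. So all
  intact servers become ready, and they are a quorum of the full system that every correct server
  hears from.\<close>

section \<open>Intact servers\<close>

text \<open>The predicate under \<open>GREATEST\<close> in \<open>intact\<close>, named so that its
  closure under unions can be stated.\<close>

definition intact_candidate :: "'n set \<Rightarrow> ('n \<Rightarrow> 'n set set) \<Rightarrow> 'n set \<Rightarrow> 'n set \<Rightarrow> bool" where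
  "intact_candidate V S F I \<longleftrightarrow> I \<subseteq> V \<and> I \<inter> F = {} \<and> (I \<noteq> {} \<longrightarrow> I \<in> quorums V S) \<and>
     quorum_intersection I (restrict_fbqs S I)"

lemma in_restricted_quorums_iff:
  "U \<in> quorums I (restrict_fbqs S I) \<longleftrightarrow>
     U \<noteq> {} \<and> U \<subseteq> I \<and> (\<forall>v\<in>U. \<exists>q\<in>S v. q \<inter> I \<subseteq> U)"
  unfolding quorums_def restrict_fbqs_def by blast

text \<open>\<open>U\<close> need not lie inside \<open>I\<close>: it may be a quorum of a larger
  system, or a complement.\<close>

lemma restricted_quorumI:
  assumes "U \<inter> I \<noteq> {}" and "\<And>v. v \<in> U \<inter> I \<Longrightarrow> \<exists>q\<in>S v. q \<inter> I \<subseteq> U"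
  shows "U \<inter> I \<in> quorums I (restrict_fbqs S I)"
  using assms by (simp add: in_restricted_quorums_iff Int_lower2)

lemma restricted_quorum_slice:
  assumes "U \<in> quorums I (restrict_fbqs S I)" and "v \<in> U"
  shows "\<exists>q\<in>S v. q \<inter> I \<subseteq> U"
  using assms by (simp add: in_restricted_quorums_iff)

lemma restricted_quorums_meet:
  assumes "quorum_intersection I (restrict_fbqs S I)"
    and "U \<in> quorums I (restrict_fbqs S I)" and "U' \<in> quorums I (restrict_fbqs S I)"
  shows "U \<inter> U' \<noteq> {}"
  using assms unfolding quorum_intersection_def by blast

lemma quorum_slice:
  assumes "U \<in> quorums V S" and "v \<in> U"
  shows "\<exists>q\<in>S v. q \<subseteq> U"
  using assms unfolding quorums_def by blast

lemma quorums_Un: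
  assumes "U \<in> quorums V S" and "U' \<in> quorums V S"
  shows "U \<union> U' \<in> quorums V S"
proof -
  have "\<exists>q\<in>S v. q \<subseteq> U \<union> U'" if "v \<in> U \<union> U'" for v
    using that quorum_slice[OF assms(1), of v] quorum_slice[OF assms(2), of v]
    by (metis Un_iff le_supI1 le_supI2)
  with assms show ?thesis unfolding quorums_def by simp
qed

text \<open>A \<open>U\<close> missing \<open>I\<close> would lie in \<open>J\<close> and be a
  quorum of the restriction to \<open>J\<close>. So is \<open>I \<inter> J\<close>, which is
  non-empty because \<open>I\<close> and \<open>J\<close> are quorums of \<open>S\<close>. The two
  would be disjoint.\<close>

lemma quorum_of_union_meets_left:
  assumes qi: "quorum_intersection V S"
    and I: "I \<in> quorums V S" and J: "J \<in> quorums V S"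
    and qiJ: "quorum_intersection J (restrict_fbqs S J)"
    and U: "U \<in> quorums (I \<union> J) (restrict_fbqs S (I \<union> J))"
  shows "U \<inter> I \<noteq> {}"
proof
  assume empty: "U \<inter> I = {}"
  have U': "U \<noteq> {}" "U \<subseteq> I \<union> J"
    using U unfolding in_restricted_quorums_iff by auto
  have "U \<inter> J \<in> quorums J (restrict_fbqs S J)"
  proof (rule restricted_quorumI)
    show "U \<inter> J \<noteq> {}" using U' empty by blast
    show "\<exists>q\<in>S v. q \<inter> J \<subseteq> U" if "v \<in> U \<inter> J" for v
      using restricted_quorum_slice[OF U, of v] that by blast
  qed
  moreover have "I \<inter> J \<in> quorums J (restrict_fbqs S J)"
  proof (rule restricted_quorumI)
    show "I \<inter> J \<noteq> {}"
      using qi I J unfolding quorum_intersection_def by blast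
    show "\<exists>q\<in>S v. q \<inter> J \<subseteq> I" if "v \<in> I \<inter> J" for v
      using quorum_slice[OF I, of v] that by blast
  qed
  ultimately have "(U \<inter> J) \<inter> (I \<inter> J) \<noteq> {}"
    by (rule restricted_quorums_meet[OF qiJ])
  with empty show False by blast
qed

text \<open>Quorums of the restriction to \<open>I \<union> J\<close> leave traces on
  \<open>I\<close> that are quorums of the restriction to \<open>I\<close>, and those traces
  meet.\<close>

lemma intact_candidate_Un:
  assumes qi: "quorum_intersection V S"
    and I: "intact_candidate V S F I" and J: "intact_candidate V S F J"
  shows "intact_candidate V S F (I \<union> J)"
proof (cases "I = {} \<or> J = {}")
  case True
  then show ?thesis using I J by auto
next
  case False
  then have quor: "I \<in> quorums V S" "J \<in> quorums V S"
    and qiI: "quorum_intersection I (restrict_fbqs S I)"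
    and qiJ: "quorum_intersection J (restrict_fbqs S J)"
    using I J unfolding intact_candidate_def by auto
  have trace: "U \<inter> I \<in> quorums I (restrict_fbqs S I)"
    if U: "U \<in> quorums (I \<union> J) (restrict_fbqs S (I \<union> J))" for U
  proof (rule restricted_quorumI)
    show "U \<inter> I \<noteq> {}" using quorum_of_union_meets_left[OF qi quor qiJ U] .
    show "\<exists>q\<in>S v. q \<inter> I \<subseteq> U" if "v \<in> U \<inter> I" for v
      using restricted_quorum_slice[OF U, of v] that by blast
  qed
  have "quorum_intersection (I \<union> J) (restrict_fbqs S (I \<union> J))"
    unfolding quorum_intersection_def using restricted_quorums_meet[OF qiI trace trace] by blast
  with quorums_Un[OF quor] show ?thesis
    using I J unfolding intact_candidate_def by blast
qed

text \<open>In a finite family closed under unions, a maximal member is the greatest one, so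
  \<open>GREATEST\<close> denotes an actual candidate.\<close>

lemma intact_candidate_intact:
  assumes "finite V" and qi: "quorum_intersection V S"
  shows "intact_candidate V S F (intact V S F)"
proof -
  let ?P = "{I. intact_candidate V S F I}"
  have "?P \<subseteq> Pow V" unfolding intact_candidate_def by blast
  then have "finite ?P" using \<open>finite V\<close> finite_subset by blast
  moreover have "{} \<in> ?P"
    unfolding intact_candidate_def quorum_intersection_def quorums_def by simp
  ultimately obtain I where I: "I \<in> ?P" and max: "\<forall>J\<in>?P. I \<subseteq> J \<longrightarrow> I = J"
    by (metis finite_has_maximal empty_iff)
  have greatest: "J \<subseteq> I" if "intact_candidate V S F J" for J
    using intact_candidate_Un[OF qi] I that max by blast
  have "intact V S F = I"
    unfolding intact_def using I greatest
    by (intro Greatest_equality) (auto simp: intact_candidate_def)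
  with I show ?thesis by simp
qed

section \<open>Single steps\<close>

fun guard :: "handler \<Rightarrow> ('n, 'a) local_state \<Rightarrow> bool" where
  "guard Echo l = echoed l"
| "guard Ready_Quorum l = ready l"
| "guard Ready_Blocking l = ready l"
| "guard Deliver l = delivered l"

text \<open>A representative of the handlers that share a guard variable.\<close>

fun guard_class :: "handler \<Rightarrow> handler" where
  "guard_class Ready_Blocking = Ready_Quorum"
| "guard_class h = h"

text \<open>Identifies the event by which a correct node sends a message, so that
  \<open>sent\<close> and \<open>rcvd\<close> can be traced back to events.\<close>

fun emits :: "'n \<Rightarrow> 'n \<Rightarrow> 'a msg \<Rightarrow> ('n, 'a) event \<Rightarrow> bool" where
  "emits c u (BCAST a) e \<longleftrightarrow> u = c \<and> e = Broadcast a"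
| "emits c u (ECHO a) e \<longleftrightarrow> e = Handle u Echo a"
| "emits c u (READY a) e \<longleftrightarrow> e = Handle u Ready_Quorum a \<or> e = Handle u Ready_Blocking a"

lemma enabled_not_guard: "enabled V c S s v h a \<Longrightarrow> \<not> guard h (loc s v)"
  by (cases h) auto

text \<open>Apart from the guard, each handler's condition is monotone in the received
  messages.\<close>

lemma enabled_mono:
  assumes "enabled V c S s v h a" and "rcvd (loc s v) \<subseteq> rcvd (loc s' v)"
    and "\<not> guard h (loc s' v)"
  shows "enabled V c S s' v h a"
  using assms by (cases h) (simp; blast)+

lemma loc_effect:
  "loc (effect V v h a s) w =
    (if w \<noteq> v then loc s w else case guard_class h of
       Echo \<Rightarrow> (loc s v)\<lparr>echoed := True\<rparr>
     | Deliver \<Rightarrow> (loc s v)\<lparr>delivered := True\<rparr>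
     | _ \<Rightarrow> (loc s v)\<lparr>ready := True\<rparr>)"
  by (cases h) (auto simp: send_all_def set_local_def)

lemma guard_step:
  assumes "step C V c Bad S s e s'" and "v \<notin> Bad"
  shows "guard h (loc s' v) \<longleftrightarrow>
    guard h (loc s v) \<or> (\<exists>h' a. e = Handle v h' a \<and> guard_class h' = guard_class h)"
  using assms
proof cases
  case (receive w u m)
  then show ?thesis by (cases h) (auto simp: set_local_def)
next
  case (handle w h' a)
  from handle(1,2) show ?thesis
    by (cases h; cases h') (auto simp: loc_effect simp del: effect.simps)
next
  case (byzantine b)
  \<comment> \<open>A Byzantine event changes only the state of its own node, and \<open>v\<close>,
    being correct, is a different node.\<close>
  then have "loc s' v = loc s v" using assms(2) by metis
  then show ?thesis using byzantine by simp
qed (auto simp: send_all_def)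

lemma rcvd_step:
  assumes "step C V c Bad S s e s'" and "v \<notin> Bad"
  shows "rcvd (loc s' v) = rcvd (loc s v) \<union> {(u, m). e = Receive v u m}"
  using assms
proof cases
  case (handle w h a)
  from handle(1,2) show ?thesis by (cases h) (auto simp: loc_effect simp del: effect.simps)
next
  case (byzantine b)
  then have "loc s' v = loc s v" using assms(2) by metis
  then show ?thesis using byzantine by simp
qed (auto simp: send_all_def set_local_def)

lemma sent_step:
  assumes "step C V c Bad S s e s'" and "u \<notin> Bad"
  shows "(u, w, m) \<in> sent s' \<longleftrightarrow> (u, w, m) \<in> sent s \<or> w \<in> V \<and> emits c u m e"
  using assms
proof cases
  case (broadcast a)
  then show ?thesis by (cases m) (auto simp: send_all_def)
next
  case (receive v u' m')
  then show ?thesis by (cases m) (auto simp: set_local_def)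
next
  case (handle v h a)
  from handle(1,2) show ?thesis by (cases h; cases m) (auto simp: send_all_def set_local_def)
next
  case (byzantine b)
  then have "(u, w, m) \<in> sent s' \<longleftrightarrow> (u, w, m) \<in> sent s" using assms(2) by metis
  then show ?thesis using byzantine by (cases m) auto
next
  case idle
  then show ?thesis by (cases m) auto
qed

section \<open>Executions\<close>

locale stellar_execution =
  fixes C V Bad :: "'n set" and c :: 'n and S :: "'n \<Rightarrow> 'n set set"
    and \<sigma> :: "nat \<Rightarrow> ('n, 'a) config" and \<epsilon> :: "nat \<Rightarrow> ('n, 'a) event"
  assumes finite_V: "finite V"
    and qi: "quorum_intersection V S"
    and exec: "execution C V c Bad S \<sigma> \<epsilon>"
    and intact_nonempty: "intact V S (V \<inter> Bad) \<noteq> {}"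
begin

abbreviation I :: "'n set" where
  "I \<equiv> intact V S (V \<inter> Bad)"

lemma init: "\<sigma> 0 = init_config"
  and steps: "step C V c Bad S (\<sigma> t) (\<epsilon> t) (\<sigma> (Suc t))"
  and single_broadcast: "\<epsilon> t = Broadcast a \<Longrightarrow> \<epsilon> t' = Broadcast a' \<Longrightarrow> a = a'"
  and reliable: "v \<in> V - Bad \<Longrightarrow> u \<notin> Bad \<Longrightarrow> (u, v, m) \<in> sent (\<sigma> t) \<Longrightarrow>
    \<exists>t'. (u, m) \<in> rcvd (loc (\<sigma> t') v)"
  and fair: "v \<in> V - Bad \<Longrightarrow> (\<And>t'. t' \<ge> t \<Longrightarrow> enabled V c S (\<sigma> t') v h a) \<Longrightarrow>
    \<exists>t'\<ge>t. \<epsilon> t' = Handle v h a"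
  using exec unfolding execution_def by blast+

lemma intact_candidate_I: "intact_candidate V S (V \<inter> Bad) I"
  using finite_V qi by (rule intact_candidate_intact)

lemma I_correct: "I \<subseteq> V - Bad"
  and I_quorum: "I \<in> quorums V S"
  and I_intersection: "quorum_intersection I (restrict_fbqs S I)"
  using intact_candidate_I intact_nonempty unfolding intact_candidate_def by auto

text \<open>The trace is non-empty because \<open>I\<close> is itself a quorum of \<open>S\<close>,
  and quorums of \<open>S\<close> intersect.\<close>

lemma quorum_trace:
  assumes "U \<in> quorums V S"
  shows "U \<inter> I \<in> quorums I (restrict_fbqs S I)"
proof (rule restricted_quorumI)
  show "U \<inter> I \<noteq> {}"
    using assms I_quorum qi unfolding quorum_intersection_def by blast
  show "\<exists>q\<in>S v. q \<inter> I \<subseteq> U" if "v \<in> U \<inter> I" for v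
    using quorum_slice[OF assms, of v] that by blast
qed

lemma quorums_meet_intact:
  assumes "U \<in> quorums V S" and "U' \<in> quorums V S"
  shows "\<exists>u\<in>I. u \<in> U \<and> u \<in> U'"
  using restricted_quorums_meet[OF I_intersection quorum_trace[OF assms(1)] quorum_trace[OF assms(2)]]
  by blast

lemma quorum_meets_intact:
  assumes "U \<in> quorums V S"
  shows "\<exists>u\<in>I. u \<in> U"
  using quorums_meet_intact[OF assms assms] by blast

section \<open>Guards and messages as records of past events\<close>

lemma handle_enabled:
  assumes "\<epsilon> t = Handle v h a"
  shows "v \<in> V - Bad" and "enabled V c S (\<sigma> t) v h a"
  using steps[of t] unfolding assms by (auto elim: step.cases)

text \<open>The inequality is strict because \<open>\<sigma> t\<close> is the configuration before
  the event at \<open>t\<close>.\<close>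

lemma guard_iff:
  assumes "v \<notin> Bad"
  shows "guard h (loc (\<sigma> t) v) \<longleftrightarrow>
    (\<exists>t'<t. \<exists>h' a. \<epsilon> t' = Handle v h' a \<and> guard_class h' = guard_class h)"
proof (induction t)
  case 0
  then show ?case by (cases h) (auto simp: init init_config_def)
next
  case (Suc t)
  then show ?case unfolding guard_step[OF steps assms] less_Suc_eq by blast
qed

lemma handle_not_before:
  assumes e: "\<epsilon> t = Handle v h a" and e': "\<epsilon> t' = Handle v h' a'"
    and cls: "guard_class h = guard_class h'"
  shows "\<not> t < t'"
proof
  assume "t < t'"
  moreover have "v \<notin> Bad" using handle_enabled(1)[OF e] by simp
  ultimately have "guard h' (loc (\<sigma> t') v)" using guard_iff[of v h' t'] e cls by auto
  with enabled_not_guard[OF handle_enabled(2)[OF e']] show False by contradiction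
qed

text \<open>Equal times mean equal events, hence also equal values.\<close>

lemma handle_unique:
  assumes "\<epsilon> t = Handle v h a" and "\<epsilon> t' = Handle v h' a'" and "guard_class h = guard_class h'"
  shows "t = t'"
  using handle_not_before[OF assms] handle_not_before[OF assms(2,1) assms(3)[symmetric]] by simp

lemma sent_iff:
  assumes "u \<notin> Bad"
  shows "(u, w, m) \<in> sent (\<sigma> t) \<longleftrightarrow> w \<in> V \<and> (\<exists>t'<t. emits c u m (\<epsilon> t'))"
proof (induction t)
  case 0
  then show ?case by (simp add: init init_config_def)
next
  case (Suc t)
  then show ?case unfolding sent_step[OF steps assms] less_Suc_eq by blast
qed

lemma rcvd_mono:
  assumes "v \<notin> Bad" and "t \<le> t'"
  shows "rcvd (loc (\<sigma> t) v) \<subseteq> rcvd (loc (\<sigma> t') v)"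
  using assms(2) by (rule lift_Suc_mono_le[rotated]) (use rcvd_step[OF steps assms(1)] in blast)

lemma rcvd_emitted:
  assumes "v \<notin> Bad" and "u \<notin> Bad" and "(u, m) \<in> rcvd (loc (\<sigma> t) v)"
  shows "\<exists>t'<t. emits c u m (\<epsilon> t')"
  using assms(3)
proof (induction t)
  case 0
  then show ?case by (simp add: init init_config_def)
next
  case (Suc t)
  show ?case
  proof (cases "(u, m) \<in> rcvd (loc (\<sigma> t) v)")
    case True
    then show ?thesis using Suc.IH less_Suc_eq by blast
  next
    case False
    then have "\<epsilon> t = Receive v u m"
      using Suc.prems unfolding rcvd_step[OF steps assms(1)] by blast
    then have "(u, v, m) \<in> sent (\<sigma> t)"
      using steps[of t] assms(2) by (auto elim: step.cases)
    then show ?thesis unfolding sent_iff[OF assms(2)] using less_Suc_eq by blast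
  qed
qed

section \<open>Eventual receipt and eventual handling\<close>

lemma emitted_rcvd:
  assumes "v \<in> V - Bad" and "u \<notin> Bad" and "emits c u m (\<epsilon> t)"
  shows "\<exists>t'. (u, m) \<in> rcvd (loc (\<sigma> t') v)"
  \<comment> \<open>The event at \<open>t\<close> shows in \<open>sent\<close> from configuration
    \<open>Suc t\<close> on.\<close>
  using assms reliable[OF assms(1,2), of m "Suc t"] sent_iff[OF assms(2)] by blast

text \<open>Each message arrives at its own time; finiteness of \<open>U\<close> and monotonicity of
  \<open>rcvd\<close> give a common one.\<close>

lemma emitted_rcvd_all:
  assumes v: "v \<in> V - Bad" and "finite U" and "U \<inter> Bad = {}"
    and "\<And>u. u \<in> U \<Longrightarrow> \<exists>t. emits c u m (\<epsilon> t)"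
  shows "\<exists>t. \<forall>u\<in>U. (u, m) \<in> rcvd (loc (\<sigma> t) v)"
  using assms(2-)
proof (induction U)
  case empty
  then show ?case by simp
next
  case (insert x U)
  have "\<exists>t. \<forall>u\<in>U. (u, m) \<in> rcvd (loc (\<sigma> t) v)"
  proof (rule insert.IH)
    show "U \<inter> Bad = {}" using insert.prems(1) by simp
    show "\<exists>t. emits c u m (\<epsilon> t)" if "u \<in> U" for u using insert.prems(2) that by simp
  qed
  then obtain t where t: "\<forall>u\<in>U. (u, m) \<in> rcvd (loc (\<sigma> t) v)" ..
  have "x \<notin> Bad" using insert.prems(1) by simp
  moreover obtain t0 where "emits c x m (\<epsilon> t0)" using insert.prems(2)[of x] by auto
  ultimately obtain t' where t': "(x, m) \<in> rcvd (loc (\<sigma> t') v)"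
    using emitted_rcvd[OF v] by blast
  have "\<forall>u\<in>insert x U. (u, m) \<in> rcvd (loc (\<sigma> (max t t')) v)"
    using t t' rcvd_mono[of v t "max t t'"] rcvd_mono[of v t' "max t t'"] v by auto
  then show ?case by blast
qed

text \<open>If no handler of the class ever ran, the guard would stay unset, so the handler would
  remain enabled and fairness would execute it. Handler and value are left open, since another
  instance may have set the guard first.\<close>

lemma progress:
  assumes v: "v \<in> V - Bad"
    and en: "\<not> guard h (loc (\<sigma> t) v) \<Longrightarrow> enabled V c S (\<sigma> t) v h a"
  shows "\<exists>t' h' a'. \<epsilon> t' = Handle v h' a' \<and> guard_class h' = guard_class h"
proof (rule ccontr)
  assume none: "\<not> ?thesis"
  then have unguarded: "\<not> guard h (loc (\<sigma> t') v)" for t'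
    using guard_iff v by blast
  then have "enabled V c S (\<sigma> t') v h a" if "t' \<ge> t" for t'
    using enabled_mono[OF en[OF unguarded]] rcvd_mono that v by blast
  with fair[OF v] none show False by blast
qed

section \<open>The common value of ready intact servers\<close>

definition becomes_ready :: "'n \<Rightarrow> 'a \<Rightarrow> bool" where
  "becomes_ready v a \<longleftrightarrow> (\<exists>t. emits c v (READY a) (\<epsilon> t))"

lemma becomes_readyI:
  assumes "\<epsilon> t = Handle v h a" and "guard_class h = Ready_Quorum"
  shows "becomes_ready v a"
  using assms unfolding becomes_ready_def by (cases h) auto

text \<open>Strong induction on time: readiness caused by a blocking set leads back to an intact
  server that was ready earlier. Only \<open>U \<inter> I\<close> is covered, as receipt from a
  faulty node proves nothing about its events.\<close>

lemma ready_echo_quorum: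
  assumes "v \<in> I" and "emits c v (READY a) (\<epsilon> t)"
  shows "\<exists>U\<in>quorums V S. \<forall>u\<in>U \<inter> I. \<exists>t'<t. \<epsilon> t' = Handle u Echo a"
  using assms
proof (induction t arbitrary: v rule: less_induct)
  case (less t)
  have v: "v \<notin> Bad" using less.prems I_correct by blast
  from less.prems(2) consider "\<epsilon> t = Handle v Ready_Quorum a" | "\<epsilon> t = Handle v Ready_Blocking a"
    by auto
  then show ?case
  proof cases
    case 1
    then obtain U where U: "U \<in> quorums V S" "\<And>u. u \<in> U \<Longrightarrow> (u, ECHO a) \<in> rcvd (loc (\<sigma> t) v)"
      using handle_enabled[OF 1] by auto
    have "\<exists>t'<t. \<epsilon> t' = Handle u Echo a" if "u \<in> U \<inter> I" for u
      using rcvd_emitted[OF v _ U(2), of u] that I_correct by auto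
    with U(1) show ?thesis by blast
  next
    case 2
    then obtain B where B: "blocking S v B" "\<And>u. u \<in> B \<Longrightarrow> (u, READY a) \<in> rcvd (loc (\<sigma> t) v)"
      using handle_enabled[OF 2] by auto
    \<comment> \<open>The blocking set must hit this slice, and therefore contains an intact
      server.\<close>
    obtain q where "q \<in> S v" "q \<subseteq> I" using quorum_slice[OF I_quorum less.prems(1)] by blast
    with B obtain u where u: "u \<in> I" "(u, READY a) \<in> rcvd (loc (\<sigma> t) v)"
      unfolding blocking_def by blast
    then obtain t' where "t' < t" "emits c u (READY a) (\<epsilon> t')"
      using rcvd_emitted[OF v] I_correct by blast
    with less.IH u(1) show ?thesis by (meson less_trans)
  qed
qed

lemma ready_agreement:
  assumes "v \<in> I" and "v' \<in> I" and "becomes_ready v a" and "becomes_ready v' a'"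
  shows "a = a'"
proof -
  obtain U U' where U: "U \<in> quorums V S" "\<And>u. u \<in> U \<inter> I \<Longrightarrow> \<exists>t. \<epsilon> t = Handle u Echo a"
    and U': "U' \<in> quorums V S" "\<And>u. u \<in> U' \<inter> I \<Longrightarrow> \<exists>t. \<epsilon> t = Handle u Echo a'"
    using assms ready_echo_quorum unfolding becomes_ready_def by metis
  obtain u where "u \<in> U" "u \<in> U'" "u \<in> I" using quorums_meet_intact[OF U(1) U'(1)] by blast
  then obtain t t' where "\<epsilon> t = Handle u Echo a" "\<epsilon> t' = Handle u Echo a'"
    using U(2) U'(2) by blast
  with handle_unique[OF this] show ?thesis by simp
qed

lemma deliver_ready_quorum:
  assumes "\<epsilon> t = Handle v Deliver a"
  shows "\<exists>U\<in>quorums V S. \<forall>u\<in>U \<inter> I. \<exists>t'<t. emits c u (READY a) (\<epsilon> t')"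
proof -
  obtain U where U: "U \<in> quorums V S" "\<And>u. u \<in> U \<Longrightarrow> (u, READY a) \<in> rcvd (loc (\<sigma> t) v)"
    using handle_enabled[OF assms] by auto
  have "\<exists>t'<t. emits c u (READY a) (\<epsilon> t')" if "u \<in> U \<inter> I" for u
    using rcvd_emitted[OF _ _ U(2)] handle_enabled(1)[OF assms] that I_correct by blast
  with U(1) show ?thesis by blast
qed

lemma deliver_intact_ready:
  assumes "\<epsilon> t = Handle v Deliver a"
  shows "\<exists>u\<in>I. becomes_ready u a"
proof -
  obtain U where U: "U \<in> quorums V S" "\<forall>u\<in>U \<inter> I. \<exists>t'<t. emits c u (READY a) (\<epsilon> t')"
    using deliver_ready_quorum[OF assms] by blast
  with quorum_meets_intact[OF U(1)] show ?thesis unfolding becomes_ready_def by blast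
qed

section \<open>Spread of readiness and delivery\<close>

lemma finite_I: "finite I"
  using I_correct finite_V finite_subset by blast

text \<open>\<open>I\<close> is a quorum whose \<open>READY\<close> messages reach every correct
  server. The delivered value stays open here because \<open>progress\<close> does not fix
  it.\<close>

lemma all_intact_ready_deliver:
  assumes ready: "\<And>u. u \<in> I \<Longrightarrow> becomes_ready u a" and v: "v \<in> V - Bad"
  shows "\<exists>t a'. \<epsilon> t = Handle v Deliver a'"
proof -
  obtain t where "\<forall>u\<in>I. (u, READY a) \<in> rcvd (loc (\<sigma> t) v)"
    using emitted_rcvd_all[OF v finite_I] ready I_correct unfolding becomes_ready_def by blast
  then have "enabled V c S (\<sigma> t) v Deliver a" if "\<not> guard Deliver (loc (\<sigma> t) v)"
    using I_quorum that by auto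
  from progress[OF v this] obtain t' h a' where "\<epsilon> t' = Handle v h a'" "guard_class h = Deliver"
    by auto
  then show ?thesis by (cases h) auto
qed

lemma quorum_ready_all_intact_ready:
  assumes U: "U \<in> quorums V S" and ready: "\<And>u. u \<in> U \<inter> I \<Longrightarrow> becomes_ready u a"
    and v: "v \<in> I"
  shows "becomes_ready v a"
proof (rule ccontr)
  assume not_ready: "\<not> becomes_ready v a"
  let ?R = "{u \<in> I. becomes_ready u a}"
  \<comment> \<open>\<open>w\<close> makes \<open>?R\<close> non-empty and is the server against
    which \<open>ready_agreement\<close> compares values.\<close>
  obtain w where w: "w \<in> U" "w \<in> I" using quorum_meets_intact[OF U] by blast
  \<comment> \<open>Otherwise \<open>?R\<close> would block \<open>u\<close>, which would then
    become ready, by agreement with \<open>w\<close> for \<open>a\<close>, and so belong to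
    \<open>?R\<close>.\<close>
  have unblocked: "\<exists>q\<in>S u. q \<inter> I \<subseteq> - ?R" if u: "u \<in> - ?R \<inter> I" for u
  proof (rule ccontr)
    assume "\<not> ?thesis"
    then have blk: "blocking S u ?R" unfolding blocking_def by blast
    have u_correct: "u \<in> V - Bad" using u I_correct by blast
    have "\<exists>t. \<forall>x\<in>?R. (x, READY a) \<in> rcvd (loc (\<sigma> t) u)"
      using finite_I I_correct unfolding becomes_ready_def
      by (intro emitted_rcvd_all[OF u_correct]) auto
    then obtain t where t: "\<forall>x\<in>?R. (x, READY a) \<in> rcvd (loc (\<sigma> t) u)" ..
    moreover have "?R \<subseteq> V" "?R \<noteq> {}" using I_correct w ready by blast+
    ultimately have "enabled V c S (\<sigma> t) u Ready_Blocking a"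
      if "\<not> guard Ready_Blocking (loc (\<sigma> t) u)"
      using blk that unfolding enabled.simps guard.simps by blast
    from progress[OF u_correct this] obtain t' h a'
      where "\<epsilon> t' = Handle u h a'" "guard_class h = Ready_Quorum"
      by auto
    then have "becomes_ready u a'" by (rule becomes_readyI)
    then show False using ready_agreement[of u w a' a] u w ready by blast
  qed
  \<comment> \<open>This quorum avoids the trace of \<open>U\<close>, all of whose members are in
    \<open>?R\<close>.\<close>
  have "- ?R \<inter> I \<in> quorums I (restrict_fbqs S I)"
    using v not_ready unblocked by (intro restricted_quorumI) blast+
  from restricted_quorums_meet[OF I_intersection this quorum_trace[OF U]]
  show False using ready by blast
qed

section \<open>The five properties of reliable Byzantine broadcast\<close>

lemma echo_broadcast:
  assumes c: "c \<notin> Bad" and e: "\<epsilon> t = Handle v Echo a"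
  shows "\<exists>t'<t. \<epsilon> t' = Broadcast a"
proof -
  have "v \<notin> Bad" and "(c, BCAST a) \<in> rcvd (loc (\<sigma> t) v)"
    using handle_enabled[OF e] by simp_all
  from rcvd_emitted[OF this(1) c this(2)] show ?thesis by simp
qed

lemma no_duplication: "no_duplication V Bad \<epsilon>"
  unfolding no_duplication_def delivers_at_def using handle_unique
  by (metis event.inject(3))

text \<open>Runs backwards in time from delivery through \<open>READY\<close> and
  \<open>ECHO\<close> to the broadcast, picking one intact server from each quorum.\<close>

lemma integrity: "integrity V c Bad \<epsilon>"
  unfolding integrity_def delivers_at_def
proof (intro ballI allI impI, elim conjE)
  fix v t a
  assume d: "\<epsilon> t = Handle v Deliver a" and c: "c \<notin> Bad"
  obtain U where U: "U \<in> quorums V S" "\<And>u. u \<in> U \<inter> I \<Longrightarrow> \<exists>t'<t. emits c u (READY a) (\<epsilon> t')"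
    using deliver_ready_quorum[OF d] by blast
  obtain w where "w \<in> U" "w \<in> I" using quorum_meets_intact[OF U(1)] by blast
  with U(2) obtain t1 where t1: "t1 < t" "emits c w (READY a) (\<epsilon> t1)" by blast
  obtain U' where U': "U' \<in> quorums V S" "\<And>u. u \<in> U' \<inter> I \<Longrightarrow> \<exists>t'<t1. \<epsilon> t' = Handle u Echo a"
    using ready_echo_quorum[OF \<open>w \<in> I\<close> t1(2)] by blast
  obtain x where "x \<in> U'" "x \<in> I" using quorum_meets_intact[OF U'(1)] by blast
  with U'(2) obtain t2 where t2: "t2 < t1" "\<epsilon> t2 = Handle x Echo a" by blast
  obtain t3 where "t3 < t2" "\<epsilon> t3 = Broadcast a"
    using echo_broadcast[OF c t2(2)] by blast
  moreover have "t3 < t" using \<open>t3 < t2\<close> t1(1) t2(1) by simp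
  ultimately show "\<exists>t'<t. \<epsilon> t' = Broadcast a" by blast
qed

text \<open>The delivering servers need not be intact, so the comparison is between intact servers
  that became ready for their values.\<close>

lemma consistency: "consistency V Bad \<epsilon>"
  unfolding consistency_def delivers_at_def
  using deliver_intact_ready ready_agreement by metis

lemma totality: "totality V Bad \<epsilon>"
  unfolding totality_def delivers_at_def
proof (intro ballI allI impI)
  fix v t a v'
  assume d: "\<epsilon> t = Handle v Deliver a" and v': "v' \<in> V - Bad"
  obtain U where "U \<in> quorums V S" "\<And>u. u \<in> U \<inter> I \<Longrightarrow> becomes_ready u a"
    using deliver_ready_quorum[OF d] unfolding becomes_ready_def by blast
  then have "becomes_ready u a" if "u \<in> I" for u
    using that by (rule quorum_ready_all_intact_ready)
  then show "\<exists>t' a'. \<epsilon> t' = Handle v' Deliver a'"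
    using v' by (rule all_intact_ready_deliver)
qed

lemma echo_value:
  assumes "c \<notin> Bad" and "\<epsilon> t = Broadcast a" and "\<epsilon> t' = Handle v Echo a'"
  shows "a' = a"
  using echo_broadcast[OF assms(1,3)] single_broadcast[OF assms(2)] by blast

text \<open>At each stage \<open>progress\<close> yields only some value \<open>a'\<close>. It
  equals \<open>a\<close> by the single broadcast for echoes, by an intact member of the echo quorum
  for readiness, and by \<open>ready_agreement\<close> for delivery.\<close>

lemma validity: "validity V c Bad \<epsilon>"
  unfolding validity_def delivers_at_def
proof (intro allI impI ballI, elim conjE)
  fix t a v
  assume c: "c \<notin> Bad" and b: "\<epsilon> t = Broadcast a" and v: "v \<in> V - Bad"
  have echo: "\<exists>t. emits c u (ECHO a) (\<epsilon> t)" if u: "u \<in> I" for u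
  proof -
    have u_correct: "u \<in> V - Bad" using u I_correct by blast
    obtain t1 where "(c, BCAST a) \<in> rcvd (loc (\<sigma> t1) u)"
      using emitted_rcvd[OF u_correct c, of "BCAST a"] b by auto
    then have "enabled V c S (\<sigma> t1) u Echo a" if "\<not> guard Echo (loc (\<sigma> t1) u)"
      using that by simp
    from progress[OF u_correct this] obtain t2 h a'
      where "\<epsilon> t2 = Handle u h a'" "guard_class h = Echo" by auto
    then have "\<epsilon> t2 = Handle u Echo a'" by (cases h) auto
    with echo_value[OF c b this] show ?thesis by auto
  qed
  have ready: "becomes_ready u a" if u: "u \<in> I" for u
  proof -
    have u_correct: "u \<in> V - Bad" using u I_correct by blast
    obtain t1 where "\<forall>x\<in>I. (x, ECHO a) \<in> rcvd (loc (\<sigma> t1) u)"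
      using emitted_rcvd_all[OF u_correct finite_I] echo I_correct by blast
    then have "enabled V c S (\<sigma> t1) u Ready_Quorum a" if "\<not> guard Ready_Quorum (loc (\<sigma> t1) u)"
      using I_quorum that by auto
    from progress[OF u_correct this] obtain t2 h a'
      where "\<epsilon> t2 = Handle u h a'" "guard_class h = Ready_Quorum" by auto
    then have r: "becomes_ready u a'" by (rule becomes_readyI)
    then obtain U where "U \<in> quorums V S" "\<forall>x\<in>U \<inter> I. \<exists>t. \<epsilon> t = Handle x Echo a'"
      using ready_echo_quorum[OF u] unfolding becomes_ready_def by metis
    then have "a' = a" using quorum_meets_intact echo_value[OF c b] by (metis IntI)
    with r show ?thesis by simp
  qed
  obtain t' a' where d: "\<epsilon> t' = Handle v Deliver a'"
    using all_intact_ready_deliver[OF ready v] by blast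
  then obtain u where "u \<in> I" "becomes_ready u a'" using deliver_intact_ready by blast
  then have "a' = a" using ready ready_agreement by blast
  with d show "\<exists>t'. \<epsilon> t' = Handle v Deliver a" by blast
qed

end

theorem theorem15:
  fixes C V Bad :: "'n set" and c :: 'n and S :: "'n \<Rightarrow> 'n set set"
    and \<sigma> :: "nat \<Rightarrow> ('n, 'a) config" and \<epsilon> :: "nat \<Rightarrow> ('n, 'a) event"
  assumes "finite V" and "V \<noteq> {}" and "C \<inter> V = {}" and "c \<in> C" and "Bad \<subseteq> C \<union> V"
    and "fbqs V S" and "quorum_intersection V S"
    and "execution C V c Bad S \<sigma> \<epsilon>"
    and "intact V S (V \<inter> Bad) \<noteq> {}"
  shows "reliable_byzantine_broadcast V c Bad \<epsilon>"
proof -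
  interpret stellar_execution C V Bad c S \<sigma> \<epsilon>
    by standard (fact assms)+
  show ?thesis
    unfolding reliable_byzantine_broadcast_def
    using validity no_duplication integrity consistency totality by blast
qed

end
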